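(* Let $\mathcal F_{\rm ruc}^d$ be the class of RUC set functions on $\mathcal P(\mathbb R^d)$. Then the following hold. (1) Let $F\in\mathcal F_{\rm ruc}^d$ and let $\mathcal A:\mathbb R^{d'}\to\mathbb R^d$ be globally Lipschitz continuous, i.e. there is $L>0$ with $\|\mathcal A(x)-\mathcal A(y)\|\le L\|x-y\|$ for all $x,y\in\mathbb R^{d'}$. For $\mathcal X\in\mathcal P(\mathbb R^{d'})$ define $\mathcal A(\mathcal X):=\{\mathcal A(x):x\in\mathcal X\}$ and $G(\mathcal X):=F(\mathcal A(\mathcal X))$. Then $G\in\mathcal F_{\rm ruc}^{d'}$. (2) If $F,G\in\mathcal F_{\rm ruc}^d$, then $\alpha F+\beta G\in\mathcal F_{\rm ruc}^d$ for any $\alpha,\beta>0$. (3) If $F,G\in\mathcal F_{\rm ruc}^d$, then $\max\{F,G\}\in\mathcal F_{\rm ruc}^d$ and $\min\{F,G\}\in\mathcal F_{\rm ruc}^d$. (4) If $F,G\in\mathcal F_{\rm ruc}^d$, then $F\cdot G\in\mathcal F_{\rm ruc}^d$ and $F/G\in\mathcal F_{\rm ruc}^d$.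
   Context: $\mathcal P(\mathbb R^d)$ denotes the family of all nonempty compact subsets of $\mathbb R^d$. For compact sets $\mathcal X,\mathcal Y$ the Hausdorff distance is $d_{\rm H}(\mathcal X,\mathcal Y)=\max\{\max_{x\in\mathcal X}\min_{y\in\mathcal Y}\|x-y\|,\ \max_{y\in\mathcal Y}\min_{x\in\mathcal X}\|x-y\|\}$, where $\|\cdot\|$ is a fixed norm (the Euclidean norm by default). A positive-valued set function $F:\mathcal P(\mathbb R^d)\to\mathbb R_{++}$ is called relative uniform continuous (RUC, or RUC-regular) if for every $\epsilon>0$ there exists $\delta>0$ such that $\left|1-\max\left\{\frac{F(\mathcal X)}{F(\mathcal Y)},\frac{F(\mathcal Y)}{F(\mathcal X)}\right\}\right|\le\epsilon$ for all $\mathcal X,\mathcal Y\in\mathcal P(\mathbb R^d)$ with $d_{\rm H}(\mathcal X,\mathcal Y)\le\delta$. Operations on set functions are pointwise, e.g. $\max\{F,G\}(\mathcal X)=\max\{F(\mathcal X),G(\mathcal X)\}$. *)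

theory Defs
  imports "HOL-Analysis.Analysis"
begin

(* The fixed norm on R^d is a parameter N; the Euclidean norm is the instance N = norm. *)
definition is_norm :: "('a::real_vector \<Rightarrow> real) \<Rightarrow> bool" where
  "is_norm N \<longleftrightarrow>
     (\<forall>x. N x = 0 \<longleftrightarrow> x = 0) \<and>
     (\<forall>c x. N (c *\<^sub>R x) = \<bar>c\<bar> * N x) \<and>
     (\<forall>x y. N (x + y) \<le> N x + N y)"

lemma is_norm_norm: "is_norm (norm :: 'a::real_normed_vector \<Rightarrow> real)"
  by (simp add: is_norm_def norm_triangle_ineq)

definition ncompacts :: "(real ^ 'd) set set" where
  "ncompacts = {X. compact X \<and> X \<noteq> {}}"

(* On ncompacts the suprema and infima are attained (lemmas below), so they are the
   maxima and minima of the usual definition. *)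
definition hausdorff_dist ::
    "(real ^ 'd \<Rightarrow> real) \<Rightarrow> (real ^ 'd) set \<Rightarrow> (real ^ 'd) set \<Rightarrow> real" where
  "hausdorff_dist N X Y =
     max (SUP x\<in>X. INF y\<in>Y. N (x - y)) (SUP y\<in>Y. INF x\<in>X. N (x - y))"

(* Set functions on ncompacts are total functions whose values outside ncompacts are
   irrelevant: both positivity and the continuity condition only concern ncompacts. *)
definition ruc :: "(real ^ 'd \<Rightarrow> real) \<Rightarrow> ((real ^ 'd) set \<Rightarrow> real) set" where
  "ruc N = {F.
     (\<forall>X\<in>ncompacts. F X > 0) \<and>
     (\<forall>\<epsilon>>0. \<exists>\<delta>>0. \<forall>X\<in>ncompacts. \<forall>Y\<in>ncompacts.
        hausdorff_dist N X Y \<le> \<delta> \<longrightarrow> \<bar>1 - max (F X / F Y) (F Y / F X)\<bar> \<le> \<epsilon>)}"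

lemma is_norm_nonneg:
  assumes "is_norm N" shows "N x \<ge> 0"
proof -
  have "N (x + (-1) *\<^sub>R x) \<le> N x + N ((-1) *\<^sub>R x)" "N ((-1) *\<^sub>R x) = \<bar>-1\<bar> * N x"
       "N (x + (-1) *\<^sub>R x) = 0"
    using assms unfolding is_norm_def by (blast, blast, simp)
  then show ?thesis by simp
qed

lemma is_norm_minus_commute:
  assumes "is_norm N" shows "N (x - y) = N (y - x)"
proof -
  have "N ((-1) *\<^sub>R (y - x)) = \<bar>-1\<bar> * N (y - x)"
    using assms unfolding is_norm_def by blast
  then show ?thesis by simp
qed

lemma is_norm_diff_le:
  assumes "is_norm N" shows "\<bar>N x - N y\<bar> \<le> N (x - y)"
proof -
  have "N (x - y + y) \<le> N (x - y) + N y" "N (y - x + x) \<le> N (y - x) + N x"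
    using assms unfolding is_norm_def by blast+
  then show ?thesis using is_norm_minus_commute[OF assms, of x y] by simp
qed

lemma is_norm_le_norm:
  fixes N :: "real ^ 'd \<Rightarrow> real"
  assumes "is_norm N" shows "\<exists>C>0. \<forall>x. N x \<le> C * norm x"
proof -
  have sum_le: "N (sum f S) \<le> (\<Sum>i\<in>S. N (f i))" if "finite S" for f and S :: "'d set"
    using that
  proof (induction S)
    case empty
    have "N 0 = 0" using assms unfolding is_norm_def by blast
    then show ?case by simp
  next
    case (insert i S)
    have "N (f i + sum f S) \<le> N (f i) + N (sum f S)"
      using assms unfolding is_norm_def by blast
    then show ?case using insert by simp
  qed
  define C where "C = (\<Sum>i\<in>(UNIV :: 'd set). N (axis i 1)) + 1"
  have C0: "C > 0"
    unfolding C_def using is_norm_nonneg[OF assms] by (simp add: add_nonneg_pos sum_nonneg)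
  have "N x \<le> C * norm x" for x
  proof -
    have "N x = N (\<Sum>i\<in>UNIV. (x $ i) *\<^sub>R axis i 1)"
      using basis_expansion[of x] by (simp add: scalar_mult_eq_scaleR)
    also have "\<dots> \<le> (\<Sum>i\<in>UNIV. N ((x $ i) *\<^sub>R axis i 1))"
      by (rule sum_le) simp
    also have "\<dots> = (\<Sum>i\<in>UNIV. \<bar>x $ i\<bar> * N (axis i 1))"
      using assms unfolding is_norm_def by simp
    also have "\<dots> \<le> (\<Sum>i\<in>UNIV. norm x * N (axis i 1))"
      by (intro sum_mono mult_right_mono component_le_norm_cart is_norm_nonneg[OF assms])
    also have "\<dots> \<le> C * norm x"
      unfolding C_def by (simp add: algebra_simps sum_distrib_left)
    finally show ?thesis .
  qed
  then show ?thesis using C0 by blast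
qed

lemma is_norm_continuous:
  fixes N :: "real ^ 'd \<Rightarrow> real"
  assumes "is_norm N" shows "continuous_on S N"
proof -
  obtain C where C: "C > 0" "\<And>x. N x \<le> C * norm x"
    using is_norm_le_norm[OF assms] by blast
  have "C-lipschitz_on S N"
  proof (rule lipschitz_onI)
    fix x y
    show "dist (N x) (N y) \<le> C * dist x y"
      using is_norm_diff_le[OF assms, of x y] C(2)[of "x - y"] by (simp add: dist_norm)
  qed (use C in simp)
  then show ?thesis by (rule lipschitz_on_continuous_on)
qed

lemma hausdorff_inner_attained:
  assumes "is_norm N" "Y \<in> ncompacts"
  shows "\<exists>y\<in>Y. (INF y'\<in>Y. N (x - y')) = N (x - y) \<and> (\<forall>y'\<in>Y. N (x - y) \<le> N (x - y'))"
proof -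
  have "continuous_on Y (\<lambda>y. N (x - y))"
    by (rule continuous_on_compose2[OF is_norm_continuous[OF assms(1), of UNIV]])
       (auto intro!: continuous_intros)
  then obtain y where y: "y \<in> Y" "\<forall>y'\<in>Y. N (x - y) \<le> N (x - y')"
    using continuous_attains_inf[of Y "\<lambda>y. N (x - y)"] assms(2) by (auto simp: ncompacts_def)
  have "(INF y'\<in>Y. N (x - y')) = N (x - y)"
    using y by (intro cInf_eq_minimum) auto
  then show ?thesis using y by blast
qed

lemma hausdorff_outer_attained:
  assumes "is_norm N" "X \<in> ncompacts" "Y \<in> ncompacts"
  defines "f \<equiv> \<lambda>x. INF y\<in>Y. N (x - y)"
  shows "\<exists>x\<in>X. (SUP x'\<in>X. f x') = f x \<and> (\<forall>x'\<in>X. f x' \<le> f x)"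
proof -
  obtain C where C: "C > 0" "\<And>x. N x \<le> C * norm x"
    using is_norm_le_norm[OF assms(1)] by blast
  have step: "f x - f z \<le> C * dist x z" for x z
  proof -
    obtain y where y: "y \<in> Y" "f z = N (z - y)"
      using hausdorff_inner_attained[OF assms(1,3), of z] unfolding f_def by blast
    obtain w where w: "f x = N (x - w)" "N (x - w) \<le> N (x - y)"
      using hausdorff_inner_attained[OF assms(1,3), of x] y(1) unfolding f_def by blast
    show ?thesis
      using w y is_norm_diff_le[OF assms(1), of "x - y" "z - y"] C(2)[of "x - z"]
      by (simp add: dist_norm)
  qed
  have "C-lipschitz_on X f"
  proof (rule lipschitz_onI)
    fix x z
    show "dist (f x) (f z) \<le> C * dist x z"
      using step[of x z] step[of z x] by (simp add: dist_real_def dist_commute abs_le_iff)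
  qed (use C in simp)
  then have "continuous_on X f" by (rule lipschitz_on_continuous_on)
  then obtain x where x: "x \<in> X" "\<forall>x'\<in>X. f x' \<le> f x"
    using continuous_attains_sup[of X f] assms(2) by (auto simp: ncompacts_def)
  have "(SUP x'\<in>X. f x') = f x"
    using x by (intro cSup_eq_maximum) auto
  then show ?thesis using x by blast
qed

(* The second term of hausdorff_dist has the arguments of N (x - y) the other way round. *)
lemma hausdorff_dist_commute:
  assumes "is_norm N"
  shows "hausdorff_dist N X Y = hausdorff_dist N Y X"
  unfolding hausdorff_dist_def
  using is_norm_minus_commute[OF assms] by (simp add: max.commute)

end

theory Submission
  imports Defs
begin

text \<open>
  For positive \<open>F\<close> the larger of the two ratios is at least 1, so by symmetry of the Hausdorff
  distance regularity says that \<open>F X \<le> (1 + \<epsilon>) F Y\<close> for all sufficiently close \<open>X\<close>, \<open>Y\<close>.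
  One-sided bounds of this kind pass to positive combinations, maxima, minima and (by symmetry)
  reciprocals with the same \<open>\<epsilon>\<close>, and to products with \<open>(1 + \<epsilon>)\<^sup>2\<close>. A Lipschitz map with constant \<open>L\<close>
  enlarges Hausdorff distances by at most the factor \<open>L\<close>; as all norms on a finite-dimensional
  space are equivalent, it is continuous and so preserves compactness.
\<close>

lemma abs_one_minus_max_ratio_le_iff:
  fixes a b e :: real
  assumes "a > 0" "b > 0"
  shows "\<bar>1 - max (a / b) (b / a)\<bar> \<le> e \<longleftrightarrow> a \<le> (1 + e) * b \<and> b \<le> (1 + e) * a"
proof -
  \<comment> \<open>The two ratios are reciprocal. Hence the absolute value is the maximum minus 1,
    and a bound on it splits into one bound per ratio.\<close>
  have "max (a / b) (b / a) \<ge> 1"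
    using assms by (cases "a \<le> b") (simp_all add: le_max_iff_disj)
  then have "\<bar>1 - max (a / b) (b / a)\<bar> \<le> e \<longleftrightarrow> a / b \<le> 1 + e \<and> b / a \<le> 1 + e"
    by linarith
  then show ?thesis
    using assms by (simp add: pos_divide_le_eq)
qed

lemma ruc_iff:
  assumes "is_norm N"
  shows "F \<in> ruc N \<longleftrightarrow>
    (\<forall>X\<in>ncompacts. F X > 0) \<and>
    (\<forall>\<epsilon>>0. \<exists>\<delta>>0. \<forall>X\<in>ncompacts. \<forall>Y\<in>ncompacts.
      hausdorff_dist N X Y \<le> \<delta> \<longrightarrow> F X \<le> (1 + \<epsilon>) * F Y)"
proof (cases "\<forall>X\<in>ncompacts. F X > 0")
  case True
  \<comment> \<open>The equivalence holds for each fixed pair \<delta>, \<epsilon>: the bound on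
    \<open>F Y\<close> by \<open>F X\<close> is the one-sided bound for the swapped pair, which has
    the same distance.\<close>
  have "(\<forall>X\<in>ncompacts. \<forall>Y\<in>ncompacts. hausdorff_dist N X Y \<le> \<delta> \<longrightarrow>
          \<bar>1 - max (F X / F Y) (F Y / F X)\<bar> \<le> \<epsilon>) \<longleftrightarrow>
        (\<forall>X\<in>ncompacts. \<forall>Y\<in>ncompacts. hausdorff_dist N X Y \<le> \<delta> \<longrightarrow> F X \<le> (1 + \<epsilon>) * F Y)"
    for \<delta> \<epsilon>
    using True hausdorff_dist_commute[OF assms]
    by (simp add: abs_one_minus_max_ratio_le_iff) metis
  then show ?thesis
    using True by (simp add: ruc_def)
qed (auto simp: ruc_def)

lemma ruc_pos: "F \<in> ruc N \<Longrightarrow> X \<in> ncompacts \<Longrightarrow> F X > 0"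
  by (simp add: ruc_def)

lemma ruc_obtain2:
  assumes "is_norm N" "F \<in> ruc N" "G \<in> ruc N" "\<epsilon> > 0"
  obtains \<delta> where "\<delta> > 0"
    "\<And>X Y. X \<in> ncompacts \<Longrightarrow> Y \<in> ncompacts \<Longrightarrow> hausdorff_dist N X Y \<le> \<delta> \<Longrightarrow>
      F X \<le> (1 + \<epsilon>) * F Y \<and> G X \<le> (1 + \<epsilon>) * G Y"
proof -
  obtain \<delta>1 where "\<delta>1 > 0" and 1: "\<And>X Y. X \<in> ncompacts \<Longrightarrow> Y \<in> ncompacts \<Longrightarrow>
      hausdorff_dist N X Y \<le> \<delta>1 \<Longrightarrow> F X \<le> (1 + \<epsilon>) * F Y"
    using assms ruc_iff[OF assms(1), of F] by metis
  obtain \<delta>2 where "\<delta>2 > 0" and 2: "\<And>X Y. X \<in> ncompacts \<Longrightarrow> Y \<in> ncompacts \<Longrightarrow>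
      hausdorff_dist N X Y \<le> \<delta>2 \<Longrightarrow> G X \<le> (1 + \<epsilon>) * G Y"
    using assms ruc_iff[OF assms(1), of G] by metis
  show ?thesis
    using \<open>\<delta>1 > 0\<close> \<open>\<delta>2 > 0\<close> 1 2 by (intro that[of "min \<delta>1 \<delta>2"]) auto
qed

text \<open>Covers the operations that keep the factor \<open>1 + \<epsilon>\<close>. Assumption
  \<open>le\<close> holds for every \<open>h\<close> that is monotone and positively homogeneous of
  degree 1 on positive reals, such as positive combinations, maxima and minima. Products have degree
  2 and are treated separately.\<close>

lemma ruc_combineI:
  assumes N: "is_norm N" and F: "F \<in> ruc N" and G: "G \<in> ruc N"
    and pos: "\<And>a b. a > 0 \<Longrightarrow> b > 0 \<Longrightarrow> h a b > 0"
    and le: "\<And>\<epsilon> a b a' b'. \<epsilon> > 0 \<Longrightarrow> a > 0 \<Longrightarrow> b > 0 \<Longrightarrow> a' > 0 \<Longrightarrow> b' > 0 \<Longrightarrow>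
      a \<le> (1 + \<epsilon>) * a' \<Longrightarrow> b \<le> (1 + \<epsilon>) * b' \<Longrightarrow> h a b \<le> (1 + \<epsilon>) * h a' b'"
  shows "(\<lambda>X. h (F X) (G X)) \<in> ruc N"
  unfolding ruc_iff[OF N]
proof (intro conjI ballI allI impI)
  fix \<epsilon> :: real
  assume "\<epsilon> > 0"
  then obtain \<delta> where "\<delta> > 0" and \<delta>: "\<And>X Y. X \<in> ncompacts \<Longrightarrow> Y \<in> ncompacts \<Longrightarrow>
      hausdorff_dist N X Y \<le> \<delta> \<Longrightarrow> F X \<le> (1 + \<epsilon>) * F Y \<and> G X \<le> (1 + \<epsilon>) * G Y"
    using ruc_obtain2[OF N F G] by blast
  have "h (F X) (G X) \<le> (1 + \<epsilon>) * h (F Y) (G Y)"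
    if "X \<in> ncompacts" "Y \<in> ncompacts" "hausdorff_dist N X Y \<le> \<delta>" for X Y
    using \<delta>[OF that] that \<open>\<epsilon> > 0\<close> by (intro le) (auto simp: ruc_pos[OF F] ruc_pos[OF G])
  with \<open>\<delta> > 0\<close> show "\<exists>\<delta>>0. \<forall>X\<in>ncompacts. \<forall>Y\<in>ncompacts.
      hausdorff_dist N X Y \<le> \<delta> \<longrightarrow> h (F X) (G X) \<le> (1 + \<epsilon>) * h (F Y) (G Y)"
    by blast
qed (simp add: pos ruc_pos[OF F] ruc_pos[OF G])

lemma ruc_linear_combination:
  assumes "is_norm N" "F \<in> ruc N" "G \<in> ruc N" "\<alpha> > 0" "\<beta> > 0"
  shows "(\<lambda>X. \<alpha> * F X + \<beta> * G X) \<in> ruc N"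
proof (rule ruc_combineI[OF assms(1-3)])
  fix \<epsilon> a b a' b' :: real
  assume "a \<le> (1 + \<epsilon>) * a'" "b \<le> (1 + \<epsilon>) * b'"
  then have "\<alpha> * a \<le> \<alpha> * ((1 + \<epsilon>) * a')" "\<beta> * b \<le> \<beta> * ((1 + \<epsilon>) * b')"
    using assms(4,5) by simp_all
  then show "\<alpha> * a + \<beta> * b \<le> (1 + \<epsilon>) * (\<alpha> * a' + \<beta> * b')"
    by (simp add: algebra_simps)
qed (use assms in \<open>simp add: add_pos_pos\<close>)

lemma ruc_max:
  assumes "is_norm N" "F \<in> ruc N" "G \<in> ruc N"
  shows "(\<lambda>X. max (F X) (G X)) \<in> ruc N"
  by (rule ruc_combineI[OF assms]) (auto simp: max_mult_distrib_left)

lemma ruc_min: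
  assumes "is_norm N" "F \<in> ruc N" "G \<in> ruc N"
  shows "(\<lambda>X. min (F X) (G X)) \<in> ruc N"
  by (rule ruc_combineI[OF assms]) (auto simp: min_mult_distrib_left)

lemma ruc_mult:
  assumes N: "is_norm N" and F: "F \<in> ruc N" and G: "G \<in> ruc N"
  shows "(\<lambda>X. F X * G X) \<in> ruc N"
  unfolding ruc_iff[OF N]
proof (intro conjI ballI allI impI)
  fix \<epsilon> :: real
  assume "\<epsilon> > 0"
  \<comment> \<open>The bounds for the two factors multiply to
    \<open>(1 + \<eta>) * (1 + \<eta>)\<close>. This is at most \<open>1 + 3 * \<eta>\<close>
    because \<open>\<eta> \<le> 1\<close>, hence at most \<open>1 + \<epsilon>\<close>.\<close>
  define \<eta> where "\<eta> = min 1 (\<epsilon> / 3)"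
  have \<eta>: "\<eta> > 0" "\<eta> \<le> 1" "3 * \<eta> \<le> \<epsilon>"
    using \<open>\<epsilon> > 0\<close> by (auto simp: \<eta>_def)
  have "\<eta> * \<eta> \<le> \<eta>"
    using \<eta> by (simp add: mult_left_le)
  then have sq: "(1 + \<eta>) * (1 + \<eta>) \<le> 1 + \<epsilon>"
    unfolding distrib_left distrib_right using \<eta>(3) by linarith
  obtain \<delta> where "\<delta> > 0" and \<delta>: "\<And>X Y. X \<in> ncompacts \<Longrightarrow> Y \<in> ncompacts \<Longrightarrow>
      hausdorff_dist N X Y \<le> \<delta> \<Longrightarrow> F X \<le> (1 + \<eta>) * F Y \<and> G X \<le> (1 + \<eta>) * G Y"
    using ruc_obtain2[OF N F G \<eta>(1)] by blast
  have "F X * G X \<le> (1 + \<epsilon>) * (F Y * G Y)"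
    if "X \<in> ncompacts" "Y \<in> ncompacts" "hausdorff_dist N X Y \<le> \<delta>" for X Y
  proof -
    note pos = ruc_pos[OF F that(1)] ruc_pos[OF G that(1)]
      ruc_pos[OF F that(2)] ruc_pos[OF G that(2)]
    have "F X * G X \<le> ((1 + \<eta>) * F Y) * ((1 + \<eta>) * G Y)"
      using \<delta>[OF that] pos \<eta> by (intro mult_mono) auto
    also have "\<dots> = ((1 + \<eta>) * (1 + \<eta>)) * (F Y * G Y)"
      by (simp only: ac_simps)
    also have "\<dots> \<le> (1 + \<epsilon>) * (F Y * G Y)"
      using sq pos by (intro mult_right_mono) auto
    finally show ?thesis .
  qed
  with \<open>\<delta> > 0\<close> show "\<exists>\<delta>>0. \<forall>X\<in>ncompacts. \<forall>Y\<in>ncompacts.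
      hausdorff_dist N X Y \<le> \<delta> \<longrightarrow> F X * G X \<le> (1 + \<epsilon>) * (F Y * G Y)"
    by blast
qed (simp add: ruc_pos[OF F] ruc_pos[OF G])

text \<open>Inversion swaps the two ratios under the maximum, so the condition in
  \<open>ruc_def\<close> stays the same, with the same \<delta> for each \<epsilon>.\<close>

lemma ruc_inverse:
  assumes "F \<in> ruc N"
  shows "(\<lambda>X. inverse (F X)) \<in> ruc N"
  using assms by (simp add: ruc_def max.commute field_simps)

lemma ruc_divide:
  assumes "is_norm N" "F \<in> ruc N" "G \<in> ruc N"
  shows "(\<lambda>X. F X / G X) \<in> ruc N"
  using ruc_mult[OF assms(1,2) ruc_inverse[OF assms(3)]] by (simp add: divide_inverse)

text \<open>Infima and suprema are attained on nonempty compact sets, so a non-strict bound on the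
  distance can be tested point by point, without an extra margin.\<close>

lemma hausdorff_dist_le_iff:
  assumes N: "is_norm N" and X: "X \<in> ncompacts" and Y: "Y \<in> ncompacts"
  shows "hausdorff_dist N X Y \<le> r \<longleftrightarrow>
    (\<forall>x\<in>X. \<exists>y\<in>Y. N (x - y) \<le> r) \<and> (\<forall>y\<in>Y. \<exists>x\<in>X. N (x - y) \<le> r)"
proof -
  \<comment> \<open>Generalized over both sets: the second term of the distance is the first one
    with the sets exchanged, up to the sign of the difference.\<close>
  have SUP_le: "(SUP x\<in>X. INF y\<in>Y. N (x - y)) \<le> r \<longleftrightarrow> (\<forall>x\<in>X. \<exists>y\<in>Y. N (x - y) \<le> r)"
    if X: "X \<in> ncompacts" and Y: "Y \<in> ncompacts" for X Y
  proof -
    have INF_le: "(INF y\<in>Y. N (x - y)) \<le> r \<longleftrightarrow> (\<exists>y\<in>Y. N (x - y) \<le> r)" for x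
      using hausdorff_inner_attained[OF N Y, of x] by (auto intro: order_trans)
    have "(SUP x\<in>X. INF y\<in>Y. N (x - y)) \<le> r \<longleftrightarrow> (\<forall>x\<in>X. (INF y\<in>Y. N (x - y)) \<le> r)"
      using hausdorff_outer_attained[OF N X Y] by (auto intro: order_trans)
    then show ?thesis
      by (simp only: INF_le)
  qed
  show ?thesis
    using SUP_le[OF X Y] SUP_le[OF Y X]
    by (simp add: hausdorff_dist_def is_norm_minus_commute[OF N])
qed

text \<open>The continuous function \<open>N\<close> attains its minimum over the compact Euclidean
  unit sphere at some \<open>u\<close>. This minimum is positive, and scaling gives the constant
  \<open>inverse (N u)\<close>.\<close>

lemma norm_le_is_norm:
  fixes N :: "real ^ 'd \<Rightarrow> real"
  assumes N: "is_norm N"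
  obtains c where "c > 0" "\<And>x. norm x \<le> c * N x"
proof -
  \<comment> \<open>Any coordinate vector shows that the sphere is nonempty;
    \<open>undefined\<close> is just some index.\<close>
  have "axis undefined 1 \<in> sphere (0 :: real ^ 'd) 1"
    by simp
  then obtain u where u: "u \<in> sphere 0 1" "\<And>v. v \<in> sphere 0 1 \<Longrightarrow> N u \<le> N v"
    using continuous_attains_inf[OF compact_sphere _ is_norm_continuous[OF N]] by blast
  have "N u \<noteq> 0"
    using u(1) N by (auto simp: is_norm_def)
  then have pos: "N u > 0"
    using is_norm_nonneg[OF N, of u] by simp
  have "norm x \<le> inverse (N u) * N x" for x
  proof (cases "x = 0")
    case False
    have "N (inverse (norm x) *\<^sub>R x) = inverse (norm x) * N x"
      using N by (simp add: is_norm_def)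
    then have "N u \<le> inverse (norm x) * N x"
      using u(2)[of "inverse (norm x) *\<^sub>R x"] False by simp
    then show ?thesis
      using False pos by (simp add: field_simps)
  qed (use is_norm_nonneg[OF N] pos in simp)
  with pos show ?thesis
    by (intro that[of "inverse (N u)"]) auto
qed

lemma ruc_lipschitz_image:
  fixes N :: "real ^ 'd \<Rightarrow> real" and N' :: "real ^ 'e \<Rightarrow> real"
  assumes N: "is_norm N" and N': "is_norm N'" and F: "F \<in> ruc N"
    and L: "L > 0" and lip: "\<And>x y. N (A x - A y) \<le> L * N' (x - y)"
  shows "(\<lambda>X. F (A ` X)) \<in> ruc N'"
proof -
  obtain c where c: "c > 0" "\<And>x. norm x \<le> c * N x"
    using norm_le_is_norm[OF N] by blast
  obtain C where C: "C > 0" "\<And>x. N' x \<le> C * norm x"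
    using is_norm_le_norm[OF N'] by blast
  \<comment> \<open>Compactness refers to the Euclidean topology, so the Lipschitz bound is
    transferred to it: \<open>c\<close> passes from \<open>N\<close> to the Euclidean norm in the
    target, \<open>C\<close> from the Euclidean norm to \<open>N'\<close> in the source.\<close>
  have "(c * (L * C))-lipschitz_on UNIV A"
  proof (rule lipschitz_onI)
    fix x y
    have "dist (A x) (A y) \<le> c * N (A x - A y)"
      using c(2) by (simp add: dist_norm)
    also have "\<dots> \<le> c * (L * N' (x - y))"
      using c(1) lip by (simp add: mult_left_mono)
    also have "\<dots> \<le> c * (L * (C * norm (x - y)))"
      using c(1) L C(2) by (simp add: mult_left_mono)
    finally show "dist (A x) (A y) \<le> c * (L * C) * dist x y"
      by (simp add: dist_norm mult.assoc)
  qed (use c C L in simp)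
  then have "continuous_on X A" for X
    by (meson continuous_on_subset lipschitz_on_continuous_on subset_UNIV)
  then have image: "A ` X \<in> ncompacts" if "X \<in> ncompacts" for X
    using that by (auto simp: ncompacts_def compact_continuous_image)
  have dist: "hausdorff_dist N (A ` X) (A ` Y) \<le> L * r"
    if "X \<in> ncompacts" "Y \<in> ncompacts" "hausdorff_dist N' X Y \<le> r" for X Y r
  proof -
    \<comment> \<open>If \<open>y\<close> is a partner of \<open>x\<close> within \<open>r\<close>,
      then \<open>A y\<close> is a partner of \<open>A x\<close> within \<open>L * r\<close>; this
      works in both directions of the pointwise criterion.\<close>
    have "N (A x - A y) \<le> L * r" if "N' (x - y) \<le> r" for x y
      using lip[of x y] mult_left_mono[OF that, of L] L by linarith
    then show ?thesis
      using that by (simp add: hausdorff_dist_le_iff[OF N] hausdorff_dist_le_iff[OF N'] image) meson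
  qed
  show ?thesis
    unfolding ruc_iff[OF N']
  proof (intro conjI ballI allI impI)
    fix \<epsilon> :: real
    assume "\<epsilon> > 0"
    then obtain \<delta> where \<delta>: "\<delta> > 0" "\<And>X Y. X \<in> ncompacts \<Longrightarrow> Y \<in> ncompacts \<Longrightarrow>
        hausdorff_dist N X Y \<le> \<delta> \<Longrightarrow> F X \<le> (1 + \<epsilon>) * F Y"
      using F unfolding ruc_iff[OF N] by metis
    \<comment> \<open>The radius \<open>\<delta> / L\<close> is chosen so that the images lie within
      \<delta> of each other.\<close>
    have "F (A ` X) \<le> (1 + \<epsilon>) * F (A ` Y)"
      if "X \<in> ncompacts" "Y \<in> ncompacts" "hausdorff_dist N' X Y \<le> \<delta> / L" for X Y
      using dist[OF that] L that by (intro \<delta>(2) image) auto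
    then show "\<exists>\<delta>>0. \<forall>X\<in>ncompacts. \<forall>Y\<in>ncompacts.
        hausdorff_dist N' X Y \<le> \<delta> \<longrightarrow> F (A ` X) \<le> (1 + \<epsilon>) * F (A ` Y)"
      using \<delta>(1) L by (intro exI[of _ "\<delta> / L"]) auto
  qed (simp add: ruc_pos[OF F] image)
qed

theorem proposition2p2:
  fixes N :: "real ^ 'd \<Rightarrow> real"
    and N' :: "real ^ 'e \<Rightarrow> real"
  assumes "is_norm N" and "is_norm N'"
  shows
    "(\<forall>F\<in>ruc N. \<forall>A :: real ^ 'e \<Rightarrow> real ^ 'd.
        (\<exists>L>0. \<forall>x y. N (A x - A y) \<le> L * N' (x - y)) \<longrightarrow>
        (\<lambda>X. F (A ` X)) \<in> ruc N') \<and>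
     (\<forall>F\<in>ruc N. \<forall>G\<in>ruc N. \<forall>\<alpha>>0. \<forall>\<beta>>0.
        (\<lambda>X. \<alpha> * F X + \<beta> * G X) \<in> ruc N) \<and>
     (\<forall>F\<in>ruc N. \<forall>G\<in>ruc N.
        (\<lambda>X. max (F X) (G X)) \<in> ruc N \<and>
        (\<lambda>X. min (F X) (G X)) \<in> ruc N) \<and>
     (\<forall>F\<in>ruc N. \<forall>G\<in>ruc N.
        (\<lambda>X. F X * G X) \<in> ruc N \<and>
        (\<lambda>X. F X / G X) \<in> ruc N)"
proof (intro conjI ballI allI impI)
  fix F A
  assume "F \<in> ruc N" "\<exists>L>0. \<forall>x y. N (A x - A y) \<le> L * N' (x - y)"
  then show "(\<lambda>X. F (A ` X)) \<in> ruc N'"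
    using ruc_lipschitz_image[OF assms] by metis
qed (simp_all add: assms ruc_linear_combination ruc_max ruc_min ruc_mult ruc_divide)

end
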